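(* Let $G$ be a locally linear graph with $n=|V(G)|$ vertices and let $G^*$ be its triangle graph, with $m=|V(G^* )|$ vertices (the number of triangles of $G$). Let $A$ and $A^*$ be the adjacency matrices of $G$ and $G^*$, and let $D$ be the diagonal matrix of vertex degrees of $G$. Then \[P_{A^*}(x)=(x+3)^{m-n}\,P_{A+\frac{1}{2}D}(x+3).\] In particular, if $G$ is regular of valency $k$ (then $k$ is even and $nk=6m$), then \[P_{A^*}(x)=(x+3)^{m-n}\,P_A\!\left(x-\tfrac{k}{2}+3\right).\]
   Context: All graphs are finite, simple and undirected. A graph $G$ is locally linear if it has no isolated vertices and for every vertex $v$ the subgraph induced on its neighbourhood $N(v)=\{w\in V(G): w\sim v, w\neq v\}$ is $1$-regular; equivalently, every edge of $G$ lies in exactly one triangle (so two distinct triangles of $G$ share at most one vertex). The triangle graph $G^*$ of a locally linear graph $G$ is the graph whose vertex set is the set of triangles of $G$, two distinct triangles being adjacent in $G^*$ if and only if they share a common vertex in $G$. For a square matrix $M$ of size $r$, $P_M(x)=\det(xI_r-M)$ denotes its characteristic polynomial; when $m<n$ the identity is understood as an identity of rational functions. *)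

theory Defs
  imports
    "Graph_Theory.Digraph_Component"
    "Jordan_Normal_Form.Char_Poly"
    "HOL-Computational_Algebra.Normalized_Fraction"
begin

text \<open>
  Finite simple undirected graphs are the structures satisfying \<^locale>\<open>graph\<close>: finite symmetric
  digraphs without loops and parallel arcs.  An edge is a pair of opposite arcs, so the
  degree of a vertex is its \<^const>\<open>out_degree\<close>.
\<close>

definition neighbourhood :: "('a, 'b) pre_digraph \<Rightarrow> 'a \<Rightarrow> 'a set" where
  "neighbourhood G v = {w \<in> verts G. dominates G v w \<and> w \<noteq> v}"

definition regular :: "nat \<Rightarrow> ('a, 'b) pre_digraph \<Rightarrow> bool" where
  "regular k G \<longleftrightarrow> (\<forall>v \<in> verts G. out_degree G v = k)"

definition locally_linear :: "('a, 'b) pre_digraph \<Rightarrow> bool" where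
  "locally_linear G \<longleftrightarrow>
     (\<forall>v \<in> verts G. out_degree G v \<noteq> 0) \<and>
     (\<forall>v \<in> verts G. regular 1 (G \<restriction> neighbourhood G v))"

definition triangles :: "('a, 'b) pre_digraph \<Rightarrow> 'a set set" where
  "triangles G =
     {T. T \<subseteq> verts G \<and> card T = 3 \<and> (\<forall>u \<in> T. \<forall>v \<in> T. u \<noteq> v \<longrightarrow> dominates G u v)}"

definition triangle_graph :: "('a, 'b) pre_digraph \<Rightarrow> ('a set, 'a set \<times> 'a set) pre_digraph" where
  "triangle_graph G =
     \<lparr> verts = triangles G,
       arcs = {(S, T). S \<in> triangles G \<and> T \<in> triangles G \<and> S \<noteq> T \<and> S \<inter> T \<noteq> {}},
       tail = fst,
       head = snd \<rparr>"

text \<open>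
  Matrices are indexed by initial segments of the natural numbers, so the matrices attached
  to a graph are taken with respect to an enumeration of its vertices, that is, a list in which
  every vertex occurs exactly once.
\<close>

definition enumerates :: "'a list \<Rightarrow> 'a set \<Rightarrow> bool" where
  "enumerates xs V \<longleftrightarrow> distinct xs \<and> set xs = V"

definition adjacency_matrix :: "('a, 'b) pre_digraph \<Rightarrow> 'a list \<Rightarrow> real mat" where
  "adjacency_matrix G vs =
     mat (length vs) (length vs) (\<lambda>(i, j). if dominates G (vs ! i) (vs ! j) then 1 else 0)"

definition degree_matrix :: "('a, 'b) pre_digraph \<Rightarrow> 'a list \<Rightarrow> real mat" where
  "degree_matrix G vs = mat_diag (length vs) (\<lambda>i. real (out_degree G (vs ! i)))"

end

(*
  Let N be the vertex-triangle incidence matrix of G.  Since every edge lies in exactly one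
  triangle, a vertex of degree d lies in d/2 triangles and two distinct triangles share at most
  one vertex; hence N N^T = A + D/2 and N^T N = A' + 3I.  By Sylvester's determinant identity,
  N N^T and N^T N have the same characteristic polynomial up to a power of x.
*)
theory Submission
  imports Defs
begin

section \<open>Characteristic polynomials\<close>

text \<open>The block matrix with rows (x I, B) and (C, I) is multiplied from the right by two block
  triangular matrices, each chosen to clear one off-diagonal block. Comparing the determinants of
  the two products gives the identity. Keeping a power of x on both sides avoids division and any
  comparison of \<open>n\<close> with \<open>m\<close>.\<close>

lemma char_poly_mult_comm:
  fixes B C :: "'a :: idom mat"
  assumes B: "B \<in> carrier_mat n m" and C: "C \<in> carrier_mat m n"
  shows "[:0, 1:] ^ m * char_poly (B * C) = [:0, 1:] ^ n * char_poly (C * B)"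
proof -
  \<comment> \<open>Entries are embedded as constant polynomials; since this is a ring homomorphism,
    it commutes with matrix products.\<close>
  interpret const: comm_ring_hom "\<lambda>a :: 'a. [:a:]"
    by unfold_locales (auto simp: one_pCons)
  define X :: "'a poly" where "X = [:0, 1:]"
  define B' where "B' = map_mat (\<lambda>a. [:a:]) B"
  define C' where "C' = map_mat (\<lambda>a. [:a:]) C"
  have B': "B' \<in> carrier_mat n m" and C': "C' \<in> carrier_mat m n"
    using B C by (auto simp: B'_def C'_def)
  have BC': "B' * C' = map_mat (\<lambda>a. [:a:]) (B * C)" and CB': "C' * B' = map_mat (\<lambda>a. [:a:]) (C * B)"
    unfolding B'_def C'_def using const.mat_hom_mult[OF B C] const.mat_hom_mult[OF C B] by auto
  have BC: "char_poly (B * C) = det (X \<cdot>\<^sub>m 1\<^sub>m n + - (B' * C'))"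
    unfolding char_poly_defs BC' X_def
    by (rule arg_cong[of _ _ det], rule eq_matI) (use B C in auto)
  have CB: "char_poly (C * B) = det (X \<cdot>\<^sub>m 1\<^sub>m m + - (C' * B'))"
    unfolding char_poly_defs CB' X_def
    by (rule arg_cong[of _ _ det], rule eq_matI) (use B C in auto)
  define M where "M = four_block_mat (X \<cdot>\<^sub>m 1\<^sub>m n) B' C' (1\<^sub>m m)"
  have M: "M \<in> carrier_mat (n + m) (n + m)"
    unfolding M_def by (rule four_block_carrier_mat) auto
  \<comment> \<open>\<open>L\<close> has determinant 1 and clears the lower left block of
    \<open>M\<close>, leaving x I - B C, the Schur complement of the identity block.\<close>
  define L where "L = four_block_mat (1\<^sub>m n) (0\<^sub>m n m) (- C') (1\<^sub>m m)"
  have L: "L \<in> carrier_mat (n + m) (n + m)"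
    unfolding L_def by (rule four_block_carrier_mat) auto
  \<comment> \<open>Clearing the upper right block against x I would require dividing by x. Scaling
    the last \<open>m\<close> columns by x instead stays within polynomials and costs the factor x^m
    = det \<open>R\<close>.\<close>
  define R where "R = four_block_mat (1\<^sub>m n) (- B') (0\<^sub>m m n) (X \<cdot>\<^sub>m 1\<^sub>m m)"
  have R: "R \<in> carrier_mat (n + m) (n + m)"
    unfolding R_def by (rule four_block_carrier_mat) auto
  have M_mult_L: "M * L = four_block_mat (X \<cdot>\<^sub>m 1\<^sub>m n + - (B' * C')) B' (0\<^sub>m m n) (1\<^sub>m m)"
    unfolding M_def L_def
    apply (subst mult_four_block_mat[of _ n n _ m _ m _ _ n _ m])
    using B' C' by (auto intro!: cong_four_block_mat)
  have "X \<cdot>\<^sub>m 1\<^sub>m n * - B' + B' * (X \<cdot>\<^sub>m 1\<^sub>m m) = 0\<^sub>m n m"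
  proof -
    have "X \<cdot>\<^sub>m 1\<^sub>m n * - B' = X \<cdot>\<^sub>m (- B')"
      by (subst mult_smult_assoc_mat[of _ n n _ m]) (use B' in auto)
    moreover have "B' * (X \<cdot>\<^sub>m 1\<^sub>m m) = X \<cdot>\<^sub>m B'"
      by (subst mult_smult_distrib[of _ n m _ m]) (use B' in auto)
    ultimately show ?thesis using B' by auto
  qed
  then have M_mult_R: "M * R = four_block_mat (X \<cdot>\<^sub>m 1\<^sub>m n) (0\<^sub>m n m) C' (X \<cdot>\<^sub>m 1\<^sub>m m + - (C' * B'))"
    unfolding M_def R_def
    apply (subst mult_four_block_mat[of _ n n _ m _ m _ _ n _ m])
    using B' C' by (auto intro!: cong_four_block_mat simp: comm_add_mat[of "- (C' * B')" m m])
  have "det L = 1"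
    unfolding L_def
    by (subst det_four_block_mat_upper_right_zero[of _ n _ m]) (use C' in auto)
  then have "det M = det (M * L)"
    using det_mult[OF M L] by simp
  also have "\<dots> = char_poly (B * C)"
    unfolding M_mult_L BC
    by (subst det_four_block_mat_lower_left_zero[of _ n _ m]) (use B' C' in auto)
  finally have detM: "det M = char_poly (B * C)" .
  have "det R = X ^ m"
    unfolding R_def
    by (subst det_four_block_mat_lower_left_zero[of _ n _ m]) (use B' in auto)
  then have "det M * X ^ m = det (M * R)"
    using det_mult[OF M R] by simp
  also have "\<dots> = X ^ n * char_poly (C * B)"
    unfolding M_mult_R CB
    by (subst det_four_block_mat_upper_right_zero[of _ n _ m]) (use B' C' in auto)
  finally show ?thesis
    unfolding detM X_def by (simp add: mult.commute)
qed

text \<open>Replacing x by x + c in x I - (M + c I) gives back x I - M, and substitution, being a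
  ring homomorphism, commutes with the determinant.\<close>

lemma char_poly_add_smult_one:
  fixes M :: "'a :: idom mat"
  assumes M: "M \<in> carrier_mat n n"
  shows "char_poly M = char_poly (M + c \<cdot>\<^sub>m 1\<^sub>m n) \<circ>\<^sub>p [:c, 1:]"
  unfolding char_poly_defs comm_ring_hom.hom_det[OF pcompose_hom.comm_ring_hom_axioms, symmetric]
  by (rule arg_cong[of _ _ det], rule eq_matI) (use M in \<open>auto simp: pcompose_pCons pcompose_add pcompose_1\<close>)

section \<open>Triangles of locally linear graphs\<close>

context graph
begin

lemma adj_sym: "u \<rightarrow>\<^bsub>G\<^esub> v \<Longrightarrow> v \<rightarrow>\<^bsub>G\<^esub> u"
  using arcs_ends_symmetric[OF sym_arcs] .

lemma neighbourhood_iff: "w \<in> neighbourhood G v \<longleftrightarrow> v \<rightarrow>\<^bsub>G\<^esub> w"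
  using adj_in_verts adj_not_same by (auto simp: neighbourhood_def)

lemma finite_neighbourhood [simp]: "finite (neighbourhood G v)"
  by (simp add: neighbourhood_def)

lemma finite_triangles [simp]: "finite (triangles G)"
  by (rule finite_subset[of _ "Pow (verts G)"]) (auto simp: triangles_def)

lemma triangle_adj: "T \<in> triangles G \<Longrightarrow> u \<in> T \<Longrightarrow> v \<in> T \<Longrightarrow> u \<noteq> v \<Longrightarrow> u \<rightarrow>\<^bsub>G\<^esub> v"
  by (auto simp: triangles_def)

lemma card_triangle: "T \<in> triangles G \<Longrightarrow> card T = 3"
  by (auto simp: triangles_def)

lemma finite_triangle: "T \<in> triangles G \<Longrightarrow> finite T"
  using card_triangle by (metis card.infinite zero_neq_numeral)

text \<open>Since there are no parallel arcs, \<open>head G\<close> is injective on the arcs leaving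
  \<open>v\<close>.\<close>

lemma card_neighbourhood: "card (neighbourhood G v) = out_degree G v"
proof -
  have "bij_betw (head G) (out_arcs G v) (neighbourhood G v)"
    unfolding bij_betw_def
  proof
    show "inj_on (head G) (out_arcs G v)"
      by (auto simp: inj_on_def arc_to_ends_def intro: no_multi_arcs)
    show "head G ` out_arcs G v = neighbourhood G v"
      by (auto simp: neighbourhood_iff arcs_ends_conv)
  qed
  then show ?thesis
    unfolding out_degree_def by (metis bij_betw_same_card)
qed

text \<open>The common neighbours of \<open>u\<close> and \<open>v\<close> are the neighbours of
  \<open>v\<close> in the subgraph induced on the neighbourhood of \<open>u\<close>, which is
  1-regular.\<close>

lemma common_neighbour_unique:
  assumes "locally_linear G" "u \<rightarrow>\<^bsub>G\<^esub> v"
  shows "\<exists>!w. u \<rightarrow>\<^bsub>G\<^esub> w \<and> v \<rightarrow>\<^bsub>G\<^esub> w"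
proof -
  let ?N = "neighbourhood G u"
  have "card (out_arcs (G \<restriction> ?N) v) = 1"
    using assms adj_in_verts[OF assms(2)] neighbourhood_iff
    by (auto simp: locally_linear_def regular_def out_degree_def)
  then obtain e where e: "out_arcs (G \<restriction> ?N) v = {e}"
    by (auto simp: card_1_singleton_iff)
  have v: "v \<in> ?N" using assms(2) by (simp add: neighbourhood_iff)
  show ?thesis
  proof (rule ex1I[of _ "head G e"])
    have "e \<in> out_arcs (G \<restriction> ?N) v" using e by simp
    then show "u \<rightarrow>\<^bsub>G\<^esub> head G e \<and> v \<rightarrow>\<^bsub>G\<^esub> head G e"
      by (auto simp: neighbourhood_iff arcs_ends_conv)
  next
    fix w assume w: "u \<rightarrow>\<^bsub>G\<^esub> w \<and> v \<rightarrow>\<^bsub>G\<^esub> w"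
    then obtain f where f: "f \<in> arcs G" "tail G f = v" "head G f = w"
      by (auto simp: arcs_ends_conv)
    \<comment> \<open>Both ends of \<open>f\<close> are neighbours of \<open>u\<close>, so
      \<open>f\<close> survives in the induced subgraph and must be its only arc \<open>e\<close>
      leaving \<open>v\<close>.\<close>
    then have "f \<in> out_arcs (G \<restriction> ?N) v"
      using v w by (auto simp: neighbourhood_iff)
    then show "w = head G e" using e f by auto
  qed
qed

lemma triangle_through_edge_unique:
  assumes "locally_linear G" "u \<rightarrow>\<^bsub>G\<^esub> v"
  shows "\<exists>!T. T \<in> triangles G \<and> u \<in> T \<and> v \<in> T"
proof -
  obtain w where w: "u \<rightarrow>\<^bsub>G\<^esub> w" "v \<rightarrow>\<^bsub>G\<^esub> w"
    and uniq: "\<And>z. u \<rightarrow>\<^bsub>G\<^esub> z \<Longrightarrow> v \<rightarrow>\<^bsub>G\<^esub> z \<Longrightarrow> z = w"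
    using common_neighbour_unique[OF assms] by blast
  have ne: "u \<noteq> v" "u \<noteq> w" "v \<noteq> w"
    using assms(2) w adj_not_same by auto
  show ?thesis
  proof (rule ex1I[of _ "{u, v, w}"])
    show "{u, v, w} \<in> triangles G \<and> u \<in> {u, v, w} \<and> v \<in> {u, v, w}"
      using ne assms(2) w assms(2)[THEN adj_sym] w[THEN adj_sym]
        adj_in_verts[OF w(1)] adj_in_verts[OF w(2)]
      by (simp add: triangles_def)
  next
    fix T assume T: "T \<in> triangles G \<and> u \<in> T \<and> v \<in> T"
    \<comment> \<open>A vertex of \<open>T\<close> other than \<open>u\<close> and \<open>v\<close>
      is adjacent to both, hence is \<open>w\<close>; equal cardinalities then turn the inclusion
      into equality.\<close>
    have "T \<subseteq> {u, v, w}"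
      using T triangle_adj uniq by blast
    moreover have "card T = card {u, v, w}"
      using T card_triangle ne by simp
    ultimately show "T = {u, v, w}"
      by (intro card_subset_eq) auto
  qed
qed

lemma card_triangles_through_pair:
  assumes "locally_linear G" "u \<noteq> v"
  shows "card {T \<in> triangles G. u \<in> T \<and> v \<in> T} = (if u \<rightarrow>\<^bsub>G\<^esub> v then 1 else 0)"
proof (cases "u \<rightarrow>\<^bsub>G\<^esub> v")
  case True
  obtain T where T: "T \<in> triangles G \<and> u \<in> T \<and> v \<in> T"
    and uniq: "\<forall>S. S \<in> triangles G \<and> u \<in> S \<and> v \<in> S \<longrightarrow> S = T"
    by (rule ex1E[OF triangle_through_edge_unique[OF assms(1) True]])
  have "{S \<in> triangles G. u \<in> S \<and> v \<in> S} = {T}"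
  proof
    show "{S \<in> triangles G. u \<in> S \<and> v \<in> S} \<subseteq> {T}"
      by (rule subsetI, unfold mem_Collect_eq singleton_iff) (rule uniq[rule_format])
  qed (simp add: T)
  then show ?thesis using True by simp
next
  case False
  then have "{T \<in> triangles G. u \<in> T \<and> v \<in> T} = {}"
    using assms(2) triangle_adj by blast
  then show ?thesis using False by simp
qed

text \<open>Double counting of pairs of a neighbour \<open>u\<close> of \<open>v\<close> and a
  triangle containing both: each \<open>u\<close> occurs with one triangle, each triangle through
  \<open>v\<close> with its two other vertices.\<close>

lemma out_degree_eq_triangles:
  assumes "locally_linear G"
  shows "out_degree G v = 2 * card {T \<in> triangles G. v \<in> T}"
proof -
  let ?S = "{T \<in> triangles G. v \<in> T}"
  have one: "card {T \<in> ?S. u \<in> T} = 1" if "u \<in> neighbourhood G v" for u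
  proof -
    have "v \<rightarrow>\<^bsub>G\<^esub> u" using that by (simp add: neighbourhood_iff)
    moreover from this have "v \<noteq> u" using adj_not_same by blast
    ultimately show ?thesis
      using card_triangles_through_pair[OF assms, of v u] by (simp add: conj_assoc)
  qed
  have two: "card {u \<in> neighbourhood G v. u \<in> T} = 2" if "T \<in> ?S" for T
  proof -
    have "{u \<in> neighbourhood G v. u \<in> T} = T - {v}"
      using that triangle_adj adj_not_same by (auto simp: neighbourhood_iff)
    then show ?thesis using that card_triangle[of T] finite_triangle[of T] by simp
  qed
  have "(\<Sum>u \<in> neighbourhood G v. card {T \<in> ?S. u \<in> T}) = 2 * card ?S"
    by (rule sum_multicount) (use two in auto)
  moreover have "(\<Sum>u \<in> neighbourhood G v. card {T \<in> ?S. u \<in> T}) = card (neighbourhood G v)"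
    using one by simp
  ultimately show ?thesis by (simp add: card_neighbourhood)
qed

text \<open>Counting incidences by triangles gives 3 for each triangle, and every degree is twice
  the number of incidences at its vertex. For valency k this becomes n k = 6 m.\<close>

lemma sum_out_degree_eq_triangles:
  assumes "locally_linear G"
  shows "(\<Sum>v \<in> verts G. out_degree G v) = 6 * card (triangles G)"
proof -
  have "card {v \<in> verts G. v \<in> T} = 3" if "T \<in> triangles G" for T
  proof -
    have "{v \<in> verts G. v \<in> T} = T" using that by (auto simp: triangles_def)
    then show ?thesis using that card_triangle by simp
  qed
  then have "(\<Sum>v \<in> verts G. card {T \<in> triangles G. v \<in> T}) = 3 * card (triangles G)"
    by (intro sum_multicount) auto
  then show ?thesis
    by (simp add: out_degree_eq_triangles[OF assms] flip: sum_distrib_left)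
qed

text \<open>Two common vertices would span an edge lying in two different triangles.\<close>

lemma card_triangles_inter:
  assumes "locally_linear G" "S \<in> triangles G" "T \<in> triangles G" "S \<noteq> T"
  shows "card (S \<inter> T) = (if S \<inter> T = {} then 0 else 1)"
proof (cases "S \<inter> T = {}")
  case False
  then obtain x where x: "x \<in> S \<inter> T" by blast
  have "y = x" if "y \<in> S \<inter> T" for y
  proof (rule ccontr)
    assume "y \<noteq> x"
    then have "y \<rightarrow>\<^bsub>G\<^esub> x" using that x triangle_adj assms(2) by blast
    from triangle_through_edge_unique[OF assms(1) this] show False
      using that x assms by blast
  qed
  then have "S \<inter> T = {x}" using x by blast
  then show ?thesis by simp
qed simp

end

lemma triangle_graph_adj:
  "S \<rightarrow>\<^bsub>triangle_graph G\<^esub> T \<longleftrightarrow> S \<in> triangles G \<and> T \<in> triangles G \<and> S \<noteq> T \<and> S \<inter> T \<noteq> {}"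
  by (auto simp: triangle_graph_def arcs_ends_conv)

lemma verts_triangle_graph [simp]: "verts (triangle_graph G) = triangles G"
  by (simp add: triangle_graph_def)

section \<open>The incidence matrix\<close>

definition incidence_matrix :: "'a list \<Rightarrow> 'a set list \<Rightarrow> real mat" where
  "incidence_matrix vs ts =
     mat (length vs) (length ts) (\<lambda>(i, j). if vs ! i \<in> ts ! j then 1 else 0)"

lemma incidence_matrix_carrier [simp]:
  "incidence_matrix vs ts \<in> carrier_mat (length vs) (length ts)"
  by (simp add: incidence_matrix_def)

text \<open>Turns the entries of the two products of the incidence matrix with its transpose, which
  are sums over list positions, into cardinalities of sets of triangles or vertices.\<close>

lemma sum_enumeration:
  fixes P :: "'a \<Rightarrow> bool"
  assumes "enumerates xs V"
  shows "(\<Sum>i = 0..<length xs. if P (xs ! i) then 1 else 0 :: real) = real (card {x \<in> V. P x})"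
proof -
  have V: "distinct xs" "V = set xs" using assms by (auto simp: enumerates_def)
  have "(\<Sum>i = 0..<length xs. if P (xs ! i) then 1 else 0 :: real) = (\<Sum>x \<in> V. if P x then 1 else 0)"
    by (rule sum.reindex_bij_betw[where h = "\<lambda>i. xs ! i"])
      (use V bij_betw_nth[of xs "{0..<length xs}" V] in \<open>auto simp: lessThan_atLeast0\<close>)
  also have "\<dots> = real (card {x \<in> V. P x})"
    using V by (simp add: sum.If_cases Int_def)
  finally show ?thesis .
qed

section \<open>The two Gram matrices of the incidence matrix\<close>

context graph
begin

text \<open>Entry (i, j) counts the triangles through both vertices. On the diagonal this is half
  the degree, while adjacency contributes 0 in the absence of loops; off the diagonal it is 1
  exactly for adjacent vertices.\<close>

lemma incidence_mult_transpose:
  assumes "locally_linear G" and vs: "enumerates vs (verts G)" and ts: "enumerates ts (triangles G)"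
  shows "incidence_matrix vs ts * (incidence_matrix vs ts)\<^sup>T =
    adjacency_matrix G vs + (1 / 2) \<cdot>\<^sub>m degree_matrix G vs"
proof (rule eq_matI)
  fix i j
  assume "i < dim_row (adjacency_matrix G vs + (1 / 2) \<cdot>\<^sub>m degree_matrix G vs)"
    and "j < dim_col (adjacency_matrix G vs + (1 / 2) \<cdot>\<^sub>m degree_matrix G vs)"
  then have ij: "i < length vs" "j < length vs"
    by (auto simp: degree_matrix_def mat_diag_def)
  have "(incidence_matrix vs ts * (incidence_matrix vs ts)\<^sup>T) $$ (i, j) =
      (\<Sum>l = 0..<length ts. if vs ! i \<in> ts ! l \<and> vs ! j \<in> ts ! l then 1 else 0)"
    using ij by (auto simp: incidence_matrix_def scalar_prod_def intro!: sum.cong)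
  also have "\<dots> = real (card {T \<in> triangles G. vs ! i \<in> T \<and> vs ! j \<in> T})"
    by (rule sum_enumeration[OF ts])
  also have "\<dots> = (adjacency_matrix G vs + (1 / 2) \<cdot>\<^sub>m degree_matrix G vs) $$ (i, j)"
  proof (cases "i = j")
    case True
    then show ?thesis
      using ij adj_not_same[of "vs ! i"] out_degree_eq_triangles[OF assms(1), of "vs ! i"]
      by (auto simp: adjacency_matrix_def degree_matrix_def mat_diag_def)
  next
    case False
    then have "vs ! i \<noteq> vs ! j"
      using vs ij by (auto simp: enumerates_def nth_eq_iff_index_eq)
    from card_triangles_through_pair[OF assms(1) this] show ?thesis
      using ij False by (simp add: adjacency_matrix_def degree_matrix_def mat_diag_def)
  qed
  finally show "(incidence_matrix vs ts * (incidence_matrix vs ts)\<^sup>T) $$ (i, j) =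
    (adjacency_matrix G vs + (1 / 2) \<cdot>\<^sub>m degree_matrix G vs) $$ (i, j)" .
qed (auto simp: incidence_matrix_def degree_matrix_def mat_diag_def)

text \<open>Entry (i, j) counts the vertices common to two triangles: 3 on the diagonal, and
  otherwise 1 or 0 according to whether the triangles meet.\<close>

lemma transpose_mult_incidence:
  assumes "locally_linear G" and vs: "enumerates vs (verts G)" and ts: "enumerates ts (triangles G)"
  shows "(incidence_matrix vs ts)\<^sup>T * incidence_matrix vs ts =
    adjacency_matrix (triangle_graph G) ts + 3 \<cdot>\<^sub>m 1\<^sub>m (length ts)"
proof (rule eq_matI)
  fix i j
  assume "i < dim_row (adjacency_matrix (triangle_graph G) ts + 3 \<cdot>\<^sub>m 1\<^sub>m (length ts))"
    and "j < dim_col (adjacency_matrix (triangle_graph G) ts + 3 \<cdot>\<^sub>m 1\<^sub>m (length ts))"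
  then have ij: "i < length ts" "j < length ts" by auto
  have tri: "ts ! i \<in> triangles G" "ts ! j \<in> triangles G"
    using ij[THEN nth_mem] ts by (simp_all add: enumerates_def)
  have "((incidence_matrix vs ts)\<^sup>T * incidence_matrix vs ts) $$ (i, j) =
      (\<Sum>l = 0..<length vs. if vs ! l \<in> ts ! i \<and> vs ! l \<in> ts ! j then 1 else 0)"
    using ij by (auto simp: incidence_matrix_def scalar_prod_def intro!: sum.cong)
  also have "\<dots> = real (card {v \<in> verts G. v \<in> ts ! i \<and> v \<in> ts ! j})"
    by (rule sum_enumeration[OF vs])
  also have "{v \<in> verts G. v \<in> ts ! i \<and> v \<in> ts ! j} = ts ! i \<inter> ts ! j"
    using tri by (auto simp: triangles_def)
  also have "real (card (ts ! i \<inter> ts ! j)) =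
      (adjacency_matrix (triangle_graph G) ts + 3 \<cdot>\<^sub>m 1\<^sub>m (length ts)) $$ (i, j)"
  proof (cases "i = j")
    case True
    then show ?thesis
      using ij tri card_triangle by (simp add: adjacency_matrix_def triangle_graph_adj)
  next
    case False
    then have "ts ! i \<noteq> ts ! j"
      using ts ij by (auto simp: enumerates_def nth_eq_iff_index_eq)
    from card_triangles_inter[OF assms(1) tri this] show ?thesis
      using ij tri False \<open>ts ! i \<noteq> ts ! j\<close>
      by (simp add: adjacency_matrix_def triangle_graph_adj)
  qed
  finally show "((incidence_matrix vs ts)\<^sup>T * incidence_matrix vs ts) $$ (i, j) =
    (adjacency_matrix (triangle_graph G) ts + 3 \<cdot>\<^sub>m 1\<^sub>m (length ts)) $$ (i, j)" .
qed (auto simp: incidence_matrix_def adjacency_matrix_def)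

lemma char_poly_triangle_graph:
  assumes "locally_linear G" and vs: "enumerates vs (verts G)" and ts: "enumerates ts (triangles G)"
  shows "[:3, 1:] ^ length vs * char_poly (adjacency_matrix (triangle_graph G) ts) =
    [:3, 1:] ^ length ts *
      char_poly (adjacency_matrix G vs + (1 / 2) \<cdot>\<^sub>m degree_matrix G vs) \<circ>\<^sub>p [:3, 1:]"
proof -
  let ?A' = "adjacency_matrix (triangle_graph G) ts"
  let ?N = "incidence_matrix vs ts"
  have "?A' \<in> carrier_mat (length ts) (length ts)"
    by (simp add: adjacency_matrix_def)
  then have A': "char_poly ?A' = char_poly (?N\<^sup>T * ?N) \<circ>\<^sub>p [:3, 1:]"
    unfolding transpose_mult_incidence[OF assms] by (rule char_poly_add_smult_one)
  have "[:0, 1:] ^ length ts * char_poly (?N * ?N\<^sup>T) = [:0, 1:] ^ length vs * char_poly (?N\<^sup>T * ?N)"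
    by (rule char_poly_mult_comm) auto
  \<comment> \<open>Substituting x + 3 for x turns the powers of x into powers of x + 3 and absorbs
    the summand 3 I in the transposed product.\<close>
  then have "([:0, 1:] ^ length ts * char_poly (?N * ?N\<^sup>T)) \<circ>\<^sub>p [:3, 1:] =
      ([:0, 1:] ^ length vs * char_poly (?N\<^sup>T * ?N)) \<circ>\<^sub>p [:3, 1:]"
    by simp
  then show ?thesis
    by (simp add: pcompose_mult pcompose_hom.hom_power pcompose_pCons A'
        incidence_mult_transpose[OF assms])
qed

end

section \<open>Rational functions and the regular case\<close>

theorem theorem1:
  fixes G :: "('a, 'b) pre_digraph"
    and vs :: "'a list" and ts :: "'a set list"
    and n m :: nat and A D A' :: "real mat"
  assumes "graph G" and "locally_linear G"
    and "n = card (verts G)" and "m = card (verts (triangle_graph G))"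
    and "enumerates vs (verts G)" and "enumerates ts (verts (triangle_graph G))"
    and "A = adjacency_matrix G vs" and "D = degree_matrix G vs"
    and "A' = adjacency_matrix (triangle_graph G) ts"
  shows "to_fract (char_poly A') =
           to_fract [:3, 1:] powi (int m - int n) *
           to_fract (char_poly (A + (1 / 2) \<cdot>\<^sub>m D) \<circ>\<^sub>p [:3, 1:])
       \<and> (\<forall>k. regular k G \<longrightarrow>
             (verts G \<noteq> {} \<longrightarrow> even k) \<and> n * k = 6 * m \<and>
             to_fract (char_poly A') =
               to_fract [:3, 1:] powi (int m - int n) *
               to_fract (char_poly A \<circ>\<^sub>p [:3 - real k / 2, 1:]))"
proof -
  interpret graph G by fact
  note ll = \<open>locally_linear G\<close> and vs = \<open>enumerates vs (verts G)\<close>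
  have ts: "enumerates ts (triangles G)"
    using assms(6) by simp
  have n: "n = length vs" and m: "m = length ts" "m = card (triangles G)"
    using assms(3,4) vs ts distinct_card by (fastforce simp: enumerates_def)+
  let ?P = "char_poly (A + (1 / 2) \<cdot>\<^sub>m D) \<circ>\<^sub>p [:3, 1:]"
  have "to_fract ([:3, 1:] ^ n * char_poly A') = to_fract ([:3, 1:] ^ m * ?P)"
    using char_poly_triangle_graph[OF ll vs ts] assms(7-9) n m(1) by simp
  moreover have to_fract_power: "to_fract (p ^ l) = to_fract p ^ l" for p :: "real poly" and l
    by (induct l) auto
  \<comment> \<open>In the fraction field x + 3 is invertible, so the polynomial identity can be
    divided by its \<open>n\<close>-th power even when \<open>m\<close> < \<open>n\<close>.\<close>
  moreover have "to_fract [:3, 1 :: real:] \<noteq> 0"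
    by simp
  ultimately have main: "to_fract (char_poly A') =
      to_fract [:3, 1:] powi (int m - int n) * to_fract ?P"
    by (simp add: power_int_diff field_simps del: to_fract_eq_iff)
  have "(verts G \<noteq> {} \<longrightarrow> even k) \<and> n * k = 6 * m \<and> char_poly A \<circ>\<^sub>p [:3 - real k / 2, 1:] = ?P"
    if k: "regular k G" for k
  proof (intro conjI impI)
    have deg: "out_degree G v = k" if "v \<in> verts G" for v
      using k that by (simp add: regular_def)
    \<comment> \<open>Some vertex must exist to read off its degree: the empty graph is regular of
      every valency.\<close>
    show "even k" if "verts G \<noteq> {}"
      using that deg out_degree_eq_triangles[OF ll] by fastforce
    show "n * k = 6 * m"
      using sum_out_degree_eq_triangles[OF ll] deg assms(3) m(2) by simp
    have A: "A \<in> carrier_mat n n"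
      using assms(7) n by (simp add: adjacency_matrix_def)
    \<comment> \<open>With all degrees equal to k, half the degree matrix is the scalar matrix k/2,
      so its effect is a shift of the variable by k/2. Composing the shifts by k/2 and 3 - k/2
      yields the shift by 3.\<close>
    have "A + (1 / 2) \<cdot>\<^sub>m D = A + (real k / 2) \<cdot>\<^sub>m 1\<^sub>m n"
      by (rule eq_matI)
        (use A vs n deg nth_mem in \<open>auto simp: assms(8) degree_matrix_def mat_diag_def enumerates_def\<close>)
    moreover have "char_poly A = char_poly (A + (real k / 2) \<cdot>\<^sub>m 1\<^sub>m n) \<circ>\<^sub>p [:real k / 2, 1:]"
      using A by (rule char_poly_add_smult_one)
    ultimately show "char_poly A \<circ>\<^sub>p [:3 - real k / 2, 1:] = ?P"
      by (simp add: pcompose_pCons flip: pcompose_assoc)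
  qed
  with main show ?thesis by simp
qed

end
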